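(* Let $1<p\le q<\infty$ and $\delta>0$. Let $K:(0,\infty)\times(0,\infty)\to\mathbb{C}$ be continuous with $$|K(x,y)|\lesssim\min\{1,(xy)^{-\delta/2}\},\qquad x,y>0,$$ and let $Ff(y)=\int_0^\infty x^\delta f(x)K(x,y)\,dx$, $y>0$. Let $\beta_1,\beta_2,\gamma_1,\gamma_2\in\mathbb{R}$ satisfy $\beta_1-\gamma_1=\beta_2-\gamma_2$. If $$\beta_i=\gamma_i+\frac1q-\frac1{p'},\qquad \frac1q-\frac\delta2<\beta_i<\frac1q,\qquad i=1,2,$$ then there is a constant $C$ independent of $f$ such that $$\big\Vert x^{-\overline{\beta}'}Ff\big\Vert_q\le C\big\Vert x^{\overline{\gamma}+\delta}f\big\Vert_p$$ for every measurable $f$ (for which $Ff$ is defined, see context). Explicitly, the inequality reads $$\bigg(\int_0^1 y^{-\beta_2q}|Ff(y)|^q\,dy+\int_1^\infty y^{-\beta_1q}|Ff(y)|^q\,dy\bigg)^{1/q}\le C\bigg(\int_0^1 x^{(\gamma_1+\delta)p}|f(x)|^p\,dx+\int_1^\infty x^{(\gamma_2+\delta)p}|f(x)|^p\,dx\bigg)^{1/p}.$$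
   Context: Notation: $p'=p/(p-1)$; $\Vert f\Vert_p=\big(\int_0^\infty|f(x)|^p\,dx\big)^{1/p}$. For real $\alpha_1,\alpha_2$, put $\overline\alpha=(\alpha_1,\alpha_2)$, $\overline\alpha'=(\alpha_2,\alpha_1)$, and $x^{\overline\alpha}=x^{\alpha_1}$ for $0<x\le1$, $x^{\overline\alpha}=x^{\alpha_2}$ for $x>1$; $\overline\gamma+\delta=(\gamma_1+\delta,\gamma_2+\delta)$. $A\lesssim B$ means $A\le cB$ with $c>0$ independent of $x,y$. Functions $f$: $f:(0,\infty)\to\mathbb{C}$ is measurable with $\int_0^1x^\delta|f(x)|\,dx+\int_1^\infty x^{\delta/2}|f(x)|\,dx<\infty$, so that $Ff(y)$ is well defined for every $y>0$. *)

theory Defs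
  imports "HOL-Analysis.Analysis"
begin

definition conj_exponent :: "real \<Rightarrow> real" where
  "conj_exponent p = p / (p - 1)"

text \<open>The power \<open>x\<close> to a pair of exponents: the first one governs \<open>(0, 1]\<close>, the second \<open>(1, \<infinity>)\<close>.\<close>

definition mixed_powr :: "real \<Rightarrow> real \<times> real \<Rightarrow> real" where
  "mixed_powr x a = (if x \<le> 1 then x powr fst a else x powr snd a)"

text \<open>The norm of \<open>L\<^sup>p(0, \<infinity>)\<close>, with value \<open>\<infinity>\<close> when the integral diverges. Extended
  nonnegative reals carry no real powers, so the \<open>p\<close>-th root is spelled out by cases.
  Values of the function outside \<open>(0, \<infinity>)\<close> are irrelevant, here and below.\<close>

definition Lp_norm :: "real \<Rightarrow> (real \<Rightarrow> complex) \<Rightarrow> ennreal" where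
  "Lp_norm p f =
     (let I = (\<integral>\<^sup>+x\<in>{0<..}. ennreal (norm (f x) powr p) \<partial>lebesgue)
      in if I = \<infinity> then \<infinity> else ennreal (enn2real I powr (1 / p)))"

definition kernel_transform ::
    "real \<Rightarrow> (real \<Rightarrow> real \<Rightarrow> complex) \<Rightarrow> (real \<Rightarrow> complex) \<Rightarrow> real \<Rightarrow> complex" where
  "kernel_transform \<delta> K f y =
     (LINT x:{0<..}|lebesgue. complex_of_real (x powr \<delta>) * f x * K x y)"

text \<open>The functions for which the transform converges absolutely at every \<open>y > 0\<close> under the
  kernel bound \<open>min 1 ((x * y) powr (- \<delta> / 2))\<close>.\<close>

definition admissible :: "real \<Rightarrow> (real \<Rightarrow> complex) \<Rightarrow> bool" where
  "admissible \<delta> f \<longleftrightarrow>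
     f \<in> borel_measurable (lebesgue_on {0<..}) \<and>
     (\<integral>\<^sup>+x\<in>{0<..1}. ennreal (x powr \<delta> * norm (f x)) \<partial>lebesgue)
       + (\<integral>\<^sup>+x\<in>{1<..}. ennreal (x powr (\<delta> / 2) * norm (f x)) \<partial>lebesgue) < \<infinity>"

end

theory Submission
  imports Defs
begin

text \<open>
  The kernel is majorised by a multiplicative convolution kernel, after which a Young type
  convolution inequality on the group \<open>(0, \<infinity>)\<close> applies.

  With respect to the Haar measure \<open>dx / x\<close> of that group, the two weighted norms are the plain
  \<open>L\<^sup>p\<close> and \<open>L\<^sup>q\<close> norms of \<open>u(x) = x\<^bsup>1/p\<^esup> x\<^bsup>\<gamma>+\<delta>\<^esup> |f(x)|\<close> and of
  \<open>y\<^bsup>1/q\<^esup> y\<^bsup>-\<beta>'\<^esup> |Ff(y)|\<close>. Put \<open>a\<^sub>i = 1/q - \<beta>\<^sub>i\<close>; the hypotheses say that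
  \<open>0 < a\<^sub>i < \<delta>/2\<close> and \<open>1/p' - \<gamma>\<^sub>i = a\<^sub>i\<close>. The kernel taking \<open>u\<close> to the second function is thus at
  most a constant times \<open>W(y) / W(1/x) min {1, (x y)\<^bsup>-\<delta>/2\<^esup>}\<close>, where \<open>W(y)\<close> is \<open>y\<close> to the power
  \<open>a\<^sub>2\<close> for \<open>y \<le> 1\<close> and \<open>a\<^sub>1\<close> for \<open>y > 1\<close>. It is here that the exchange of the two exponents
  between source and target matters: both weights come from the same function \<open>W\<close>. The function
  \<open>log W(e\<^sup>t)\<close> has slopes \<open>a\<^sub>1\<close> and \<open>a\<^sub>2\<close> only, so \<open>W(y) / W(1/x)\<close> is at most \<open>(x y)\<^bsup>min\<^esup>\<close> or
  \<open>(x y)\<^bsup>max\<^esup>\<close>, with the smaller or the larger of the \<open>a\<^sub>i\<close>, according as \<open>x y \<le> 1\<close> or not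
  (\<open>mixed_powr_kernel_le_tent\<close>). The resulting majorant is a function of \<open>x y\<close> which is bounded by
  \<open>1\<close> and decays like a power at \<open>0\<close> and at \<open>\<infinity>\<close>, hence is integrable for the Haar measure
  (\<open>nn_integral_tent\<close>).

  An operator whose kernel is at most \<open>1\<close> and has uniformly bounded integrals in each variable maps
  \<open>L\<^sup>p\<close> to \<open>L\<^sup>q\<close> for every \<open>q \<ge> p\<close> (\<open>bounded_kernel_Lp_Lq\<close>): it maps \<open>L\<^sup>p\<close> to \<open>L\<^sup>p\<close> by
  Jensen and Tonelli, and to \<open>L\<^sup>\<infinity>\<close> because the kernel is bounded, and \<open>L\<^sup>q\<close> lies between these two.
\<close>

section \<open>Integral operators with bounded, doubly integrable kernel\<close>

text \<open>This is Jensen's inequality for the weight \<open>k\<close> of total mass at most \<open>H\<close>, applied to the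
  \<open>p\<close>-th power. It is obtained by integrating Young's inequality with a free parameter \<open>t\<close>.\<close>

lemma nn_integral_weighted_Jensen:
  fixes u k :: "'a \<Rightarrow> real"
  assumes [measurable]: "u \<in> borel_measurable M" "k \<in> borel_measurable M"
    and u: "\<And>x. x \<in> space M \<Longrightarrow> 0 \<le> u x" and k: "\<And>x. x \<in> space M \<Longrightarrow> 0 \<le> k x"
    and p: "1 < p" and H: "0 < H" and I: "0 \<le> I"
    and kH: "(\<integral>\<^sup>+x. ennreal (k x) \<partial>M) \<le> ennreal H"
    and kI: "(\<integral>\<^sup>+x. ennreal (u x powr p * k x) \<partial>M) = ennreal I"
  shows "(\<integral>\<^sup>+x. ennreal (u x * k x) \<partial>M) \<le> ennreal (I powr (1 / p) * H powr (1 - 1 / p))"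
proof (cases "I = 0")
  case True
  then have "AE x in M. ennreal (u x powr p * k x) = 0"
    using kI by (simp add: nn_integral_0_iff_AE)
  then have "AE x in M. ennreal (u x * k x) = 0"
    using AE_space
  proof eventually_elim
    case (elim x)
    then have "u x powr p * k x = 0"
      using k[of x] by (simp add: ennreal_eq_0_iff mult_le_0_iff) linarith
    then show ?case by auto
  qed
  then have "(\<integral>\<^sup>+x. ennreal (u x * k x) \<partial>M) = 0"
    by (subst nn_integral_0_iff_AE) auto
  then show ?thesis by simp
next
  case False
  with I have I: "0 < I" by simp
  define t where "t = (I / H) powr (1 / p)"
  have t: "0 < t" using I H by (simp add: t_def)
  have tp: "t powr p = I / H" using p I H by (simp add: t_def powr_powr)
  \<comment> \<open>Young's inequality for \<open>u / t\<close> and \<open>1\<close>; the chosen \<open>t\<close> is the \<open>p\<close>-th mean of \<open>u\<close>,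
    which makes the two terms on the right scale alike.\<close>
  have young: "u x * k x \<le> t powr (1 - p) / p * (u x powr p * k x) + t * (1 - 1 / p) * k x"
    if x: "x \<in> space M" for x
  proof -
    have "(u x / t) * 1 \<le> (u x / t) powr p / p + 1 powr (p / (p - 1)) / (p / (p - 1))"
      using p u[OF x] t by (intro Youngs_inequality) (auto simp: field_simps)
    also have "\<dots> = u x powr p / t powr p / p + (1 - 1 / p)"
      using p u[OF x] t by (simp add: powr_divide field_simps)
    finally have "t * (u x / t) \<le> t * (u x powr p / t powr p / p + (1 - 1 / p))"
      using t by (intro mult_left_mono) auto
    also have "\<dots> = t powr (1 - p) / p * u x powr p + t * (1 - 1 / p)"
      using t by (simp add: powr_diff field_simps)
    finally have "u x \<le> t powr (1 - p) / p * u x powr p + t * (1 - 1 / p)" using t by simp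
    from mult_right_mono[OF this k[OF x]] show ?thesis by (simp add: algebra_simps)
  qed
  have "(\<integral>\<^sup>+x. ennreal (u x * k x) \<partial>M) \<le>
      (\<integral>\<^sup>+x. ennreal (t powr (1 - p) / p) * ennreal (u x powr p * k x)
          + ennreal (t * (1 - 1 / p)) * ennreal (k x) \<partial>M)"
  proof (intro nn_integral_mono)
    fix x assume x: "x \<in> space M"
    show "ennreal (u x * k x) \<le> ennreal (t powr (1 - p) / p) * ennreal (u x powr p * k x)
          + ennreal (t * (1 - 1 / p)) * ennreal (k x)"
      using young[OF x] p t k[OF x]
      by (simp flip: ennreal_mult ennreal_plus add: ennreal_leI)
  qed
  also have "\<dots> = ennreal (t powr (1 - p) / p) * ennreal I
      + ennreal (t * (1 - 1 / p)) * (\<integral>\<^sup>+x. ennreal (k x) \<partial>M)"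
    by (simp add: nn_integral_add nn_integral_cmult kI)
  also have "\<dots> \<le> ennreal (t powr (1 - p) / p) * ennreal I + ennreal (t * (1 - 1 / p)) * ennreal H"
    by (intro add_mono mult_left_mono kH) auto
  also have "\<dots> = ennreal (t powr (1 - p) / p * I + t * (1 - 1 / p) * H)"
    using p t I H by (simp flip: ennreal_mult ennreal_plus)
  also have "t powr (1 - p) / p * I + t * (1 - 1 / p) * H = t * H"
    using t p I H by (simp add: powr_diff tp field_simps)
  also have "t * H = I powr (1 / p) * H powr (1 - 1 / p)"
    using I H by (simp add: t_def powr_divide powr_diff)
  finally show ?thesis .
qed

text \<open>Let \<open>J(y)\<close> be the integral of \<open>u\<^sup>p\<close> against \<open>k(\<sqdot>, y)\<close>. Jensen bounds the \<open>p\<close>-th power of the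
  transform at \<open>y\<close> by \<open>H\<^bsup>p-1\<^esup> J(y)\<close>. Since \<open>k \<le> 1\<close>, \<open>J\<close> never exceeds the total integral \<open>A\<close> of \<open>u\<^sup>p\<close>, so of the power
  \<open>J\<^bsup>q/p\<^esup>\<close> one factor \<open>J\<close> can be kept and the rest estimated by \<open>A\<^bsup>q/p-1\<^esup>\<close>; Tonelli then
  integrates the remaining \<open>J\<close> to at most \<open>H A\<close>. The finiteness of the transform is recorded
  because \<open>enn2real\<close> sends \<open>\<infinity>\<close> to \<open>0\<close>, so that the norm bound alone would say nothing there.\<close>

lemma bounded_kernel_Lp_Lq:
  fixes u :: "'a \<Rightarrow> real" and k :: "'a \<Rightarrow> 'b \<Rightarrow> real"
  assumes "sigma_finite_measure M" "sigma_finite_measure N"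
    and [measurable]: "u \<in> borel_measurable M"
      "case_prod k \<in> borel_measurable (M \<Otimes>\<^sub>M N)"
    and u: "\<And>x. x \<in> space M \<Longrightarrow> 0 \<le> u x"
    and k0: "\<And>x y. x \<in> space M \<Longrightarrow> y \<in> space N \<Longrightarrow> 0 \<le> k x y"
    and k1: "\<And>x y. x \<in> space M \<Longrightarrow> y \<in> space N \<Longrightarrow> k x y \<le> 1"
    and p: "1 < p" and pq: "p \<le> q" and H: "0 < H" and A: "0 \<le> A"
    and kM: "\<And>y. y \<in> space N \<Longrightarrow> (\<integral>\<^sup>+x. ennreal (k x y) \<partial>M) \<le> ennreal H"
    and kN: "\<And>x. x \<in> space M \<Longrightarrow> (\<integral>\<^sup>+y. ennreal (k x y) \<partial>N) \<le> ennreal H"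
    and uA: "(\<integral>\<^sup>+x. ennreal (u x powr p) \<partial>M) = ennreal A"
  shows "\<And>y. y \<in> space N \<Longrightarrow> (\<integral>\<^sup>+x. ennreal (u x * k x y) \<partial>M) < \<infinity>"
    and "(\<integral>\<^sup>+y. ennreal (enn2real (\<integral>\<^sup>+x. ennreal (u x * k x y) \<partial>M) powr q) \<partial>N)
           \<le> ennreal (A powr (q / p) * H powr (q * (1 - 1 / p) + 1))"
proof -
  interpret M: sigma_finite_measure M by fact
  interpret N: sigma_finite_measure N by fact
  interpret pair_sigma_finite M N ..
  define J where "J y = (\<integral>\<^sup>+x. ennreal (u x powr p * k x y) \<partial>M)" for y
  have [measurable]: "J \<in> borel_measurable N" unfolding J_def by measurable
  define I where "I y = enn2real (J y)" for y
  have IA: "J y = ennreal (I y) \<and> 0 \<le> I y \<and> I y \<le> A" if y: "y \<in> space N" for y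
  proof -
    have "J y \<le> (\<integral>\<^sup>+x. ennreal (u x powr p) \<partial>M)"
      unfolding J_def
    proof (intro nn_integral_mono ennreal_leI)
      fix x assume "x \<in> space M"
      then show "u x powr p * k x y \<le> u x powr p"
        using k1 y by (intro mult_left_le) auto
    qed
    then have le: "J y \<le> ennreal A" by (simp add: uA)
    then have "J y < \<infinity>" using le_less_trans by fastforce
    then have eq: "J y = ennreal (I y)" by (simp add: I_def)
    moreover have "I y \<le> A" unfolding I_def using A le by (rule enn2real_leI)
    ultimately show ?thesis by (simp add: I_def)
  qed
  have jensen: "(\<integral>\<^sup>+x. ennreal (u x * k x y) \<partial>M) \<le> ennreal (I y powr (1 / p) * H powr (1 - 1 / p))"
    if y: "y \<in> space N" for y
    using y k0 IA[OF y] by (intro nn_integral_weighted_Jensen u p H kM) (auto simp: J_def)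
  show "(\<integral>\<^sup>+x. ennreal (u x * k x y) \<partial>M) < \<infinity>" if y: "y \<in> space N" for y
    using jensen[OF y] le_less_trans by fastforce
  have pt: "enn2real (\<integral>\<^sup>+x. ennreal (u x * k x y) \<partial>M) powr q
      \<le> A powr (q / p - 1) * H powr (q * (1 - 1 / p)) * I y" if y: "y \<in> space N" for y
  proof -
    have "enn2real (\<integral>\<^sup>+x. ennreal (u x * k x y) \<partial>M) powr q
        \<le> (I y powr (1 / p) * H powr (1 - 1 / p)) powr q"
      using p pq jensen[OF y] by (intro powr_mono2 enn2real_leI) auto
    also have "\<dots> = I y powr (q / p) * H powr (q * (1 - 1 / p))"
      by (simp add: powr_mult powr_powr mult.commute)
    also have "I y powr (q / p) = I y powr (q / p - 1) * I y"
      using IA[OF y] by (cases "I y = 0") (auto simp: powr_diff)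
    also have "I y powr (q / p - 1) * I y * H powr (q * (1 - 1 / p))
        \<le> A powr (q / p - 1) * I y * H powr (q * (1 - 1 / p))"
      using IA[OF y] p pq by (intro mult_right_mono powr_mono2) auto
    finally show ?thesis by (simp add: mult_ac)
  qed
  have "(\<integral>\<^sup>+y. ennreal (enn2real (\<integral>\<^sup>+x. ennreal (u x * k x y) \<partial>M) powr q) \<partial>N)
      \<le> (\<integral>\<^sup>+y. ennreal (A powr (q / p - 1) * H powr (q * (1 - 1 / p))) * J y \<partial>N)"
  proof (intro nn_integral_mono)
    fix y assume y: "y \<in> space N"
    show "ennreal (enn2real (\<integral>\<^sup>+x. ennreal (u x * k x y) \<partial>M) powr q)
       \<le> ennreal (A powr (q / p - 1) * H powr (q * (1 - 1 / p))) * J y"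
      using pt[OF y] IA[OF y] by (simp flip: ennreal_mult add: ennreal_leI)
  qed
  also have "\<dots> = ennreal (A powr (q / p - 1) * H powr (q * (1 - 1 / p))) * (\<integral>\<^sup>+y. J y \<partial>N)"
    by (simp add: nn_integral_cmult)
  also have "(\<integral>\<^sup>+y. J y \<partial>N) = (\<integral>\<^sup>+x. (\<integral>\<^sup>+y. ennreal (u x powr p * k x y) \<partial>N) \<partial>M)"
    unfolding J_def by (rule Fubini') measurable
  also have "\<dots> = (\<integral>\<^sup>+x. ennreal (u x powr p) * (\<integral>\<^sup>+y. ennreal (k x y) \<partial>N) \<partial>M)"
  proof (intro nn_integral_cong)
    fix x assume x: "x \<in> space M"
    have "(\<integral>\<^sup>+y. ennreal (u x powr p * k x y) \<partial>N) = (\<integral>\<^sup>+y. ennreal (u x powr p) * ennreal (k x y) \<partial>N)"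
      using k0 x by (intro nn_integral_cong) (simp add: ennreal_mult)
    also have "\<dots> = ennreal (u x powr p) * (\<integral>\<^sup>+y. ennreal (k x y) \<partial>N)"
      using x by (intro nn_integral_cmult) measurable
    finally show "(\<integral>\<^sup>+y. ennreal (u x powr p * k x y) \<partial>N) = ennreal (u x powr p) * (\<integral>\<^sup>+y. ennreal (k x y) \<partial>N)" .
  qed
  also have "\<dots> \<le> (\<integral>\<^sup>+x. ennreal (u x powr p) * ennreal H \<partial>M)"
    by (intro nn_integral_mono mult_left_mono kN) auto
  also have "\<dots> = ennreal A * ennreal H"
    by (simp add: nn_integral_multc uA)
  also have "ennreal (A powr (q / p - 1) * H powr (q * (1 - 1 / p))) * (ennreal A * ennreal H)
      = ennreal (A powr (q / p) * H powr (q * (1 - 1 / p) + 1))"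
    using A H by (cases "A = 0") (auto simp flip: ennreal_mult simp: powr_diff powr_add field_simps)
  finally show "(\<integral>\<^sup>+y. ennreal (enn2real (\<integral>\<^sup>+x. ennreal (u x * k x y) \<partial>M) powr q) \<partial>N)
           \<le> ennreal (A powr (q / p) * H powr (q * (1 - 1 / p) + 1))"
    by (simp add: mult_left_mono)
qed

section \<open>A convolution kernel on the multiplicative group\<close>

text \<open>The Haar measure \<open>dx / x\<close> of the multiplicative group of positive reals.\<close>

definition mult_haar :: "real measure" where
  "mult_haar = density (lebesgue_on {0<..}) (\<lambda>x. ennreal (1 / x))"

lemma space_mult_haar [simp]: "space mult_haar = {0<..}"
  by (simp add: mult_haar_def)

lemma sets_mult_haar [measurable_cong]: "sets mult_haar = sets (lebesgue_on {0<..})"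
  by (simp add: mult_haar_def)

lemma measurable_ident_lebesgue_on [measurable]: "(\<lambda>x. x) \<in> lebesgue_on {0<..} \<rightarrow>\<^sub>M (borel :: real measure)"
  by (intro measurable_restrict_space1 measurable_completion) simp

lemma nn_integral_mult_haar:
  assumes "f \<in> borel_measurable (lebesgue_on {0<..})"
  shows "(\<integral>\<^sup>+x. f x \<partial>mult_haar) = (\<integral>\<^sup>+x\<in>{0<..}. ennreal (1 / x) * f x \<partial>lebesgue)"
  using assms unfolding mult_haar_def
  by (subst nn_integral_density) (auto simp: nn_integral_restrict_space)

lemma sigma_finite_mult_haar: "sigma_finite_measure mult_haar"
proof -
  have "sigma_finite_measure (lebesgue :: real measure)"
  proof -
    obtain A :: "real set set" where A: "countable A" "A \<subseteq> sets lborel" "\<Union>A = space lborel"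
        "\<forall>a\<in>A. emeasure lborel a \<noteq> \<infinity>"
      using lborel.sigma_finite_countable by blast
    then show ?thesis
      by (intro sigma_finite_measure.intro exI[of _ A]) auto
  qed
  then interpret sigma_finite_measure "lebesgue_on {0::real<..}"
    by (rule sigma_finite_measure_restrict_space) auto
  show ?thesis unfolding mult_haar_def
    by (subst sigma_finite_iff_density_finite) auto
qed

text \<open>In logarithmic coordinates this is a two-sided exponential: it rises with rate \<open>a\<close> up to the
  value \<open>1\<close> at \<open>z = 1\<close> and falls with rate \<open>b\<close> afterwards.\<close>

definition tent :: "real \<Rightarrow> real \<Rightarrow> real \<Rightarrow> real" where
  "tent a b z = (if z \<le> 1 then z powr a else z powr (- b))"

lemma tent_nonneg: "0 \<le> tent a b z"
  by (simp add: tent_def)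

lemma tent_le_1: "0 \<le> a \<Longrightarrow> 0 \<le> b \<Longrightarrow> 0 < z \<Longrightarrow> tent a b z \<le> 1"
  using powr_le1[of a z] powr_mono[of "-b" 0 z] by (auto simp: tent_def)

lemma borel_measurable_tent [measurable]: "tent a b \<in> borel_measurable borel"
  unfolding tent_def by measurable

text \<open>By invariance of the Haar measure the bound does not depend on \<open>y\<close>; the two summands are the
  contributions of \<open>x \<le> 1 / y\<close> and of \<open>x > 1 / y\<close>.\<close>

lemma nn_integral_tent:
  assumes a: "0 < a" and b: "0 < b" and y: "0 < y"
  shows "(\<integral>\<^sup>+x. ennreal (tent a b (x * y)) \<partial>mult_haar) \<le> ennreal (1 / a + 1 / b)"
proof -
  have below: "((\<lambda>x. y powr a * x powr (a - 1)) has_integral 1 / a) {0..1 / y}"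
    using has_integral_mult_right[OF has_integral_powr_from_0[of "a - 1" "1 / y"], of "y powr a"]
    using a y by (simp add: powr_divide)
  have above: "((\<lambda>x. y powr (- b) * x powr (- b - 1)) has_integral 1 / b) {1 / y..}"
    using has_integral_mult_right[OF has_integral_powr_to_inf[of "- b - 1" "1 / y"], of "y powr (- b)"]
    using b y by (simp add: powr_divide)
  have "(\<integral>\<^sup>+x. ennreal (tent a b (x * y)) \<partial>mult_haar)
      = (\<integral>\<^sup>+x\<in>{0<..}. ennreal (1 / x) * ennreal (tent a b (x * y)) \<partial>lebesgue)"
    by (rule nn_integral_mult_haar) measurable
  also have "\<dots> = (\<integral>\<^sup>+x\<in>{0<..}. ennreal (1 / x) * ennreal (tent a b (x * y)) \<partial>lborel)"
    by (rule nn_integral_completion)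
  also have "\<dots> \<le> (\<integral>\<^sup>+x. ennreal (indicator {0..1 / y} x * (y powr a * x powr (a - 1)))
      + ennreal (indicator {1 / y..} x * (y powr (- b) * x powr (- b - 1))) \<partial>lborel)"
  proof (intro nn_integral_mono)
    fix x :: real
    consider "x \<le> 0" | "0 < x" "x * y \<le> 1" | "0 < x" "1 < x * y" by linarith
    then show "ennreal (1 / x) * ennreal (tent a b (x * y)) * indicator {0<..} x
        \<le> ennreal (indicator {0..1 / y} x * (y powr a * x powr (a - 1)))
      + ennreal (indicator {1 / y..} x * (y powr (- b) * x powr (- b - 1)))"
    proof cases
      case 2
      then have "1 / x * tent a b (x * y) = indicator {0..1 / y} x * (y powr a * x powr (a - 1))"
        using y by (simp add: tent_def powr_mult powr_diff field_simps)
      then show ?thesis using 2 by (simp flip: ennreal_mult add: tent_nonneg)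
    next
      case 3
      then have "1 / x * tent a b (x * y) = indicator {1 / y..} x * (y powr (- b) * x powr (- b - 1))"
        using y by (simp add: tent_def powr_mult powr_diff field_simps)
      then show ?thesis using 3 by (simp flip: ennreal_mult add: tent_nonneg)
    qed auto
  qed
  also have "\<dots> = ennreal (1 / a) + ennreal (1 / b)"
    by (subst nn_integral_add)
       (auto simp: nn_integral_has_integral_lebesgue[OF _ below] nn_integral_has_integral_lebesgue[OF _ above])
  also have "\<dots> = ennreal (1 / a + 1 / b)" using a b by simp
  finally show ?thesis .
qed

section \<open>Reduction of the weighted kernel\<close>

lemma mixed_powr_nonneg: "0 \<le> mixed_powr x a"
  by (simp add: mixed_powr_def)

lemma borel_measurable_mixed_powr [measurable]: "(\<lambda>x. mixed_powr x a) \<in> borel_measurable borel"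
  unfolding mixed_powr_def by measurable

lemma powr_mult_mixed_powr:
  "x powr s * mixed_powr x (a1, a2) = mixed_powr x (s + a1, s + a2)"
  by (simp add: mixed_powr_def powr_add)

text \<open>The exponents of the two weights are exchanged, so for \<open>x\<close> and \<open>y\<close> on different sides of \<open>1\<close>
  both powers carry the same exponent and combine to a power of \<open>x y\<close>. On the same side, both
  exponents are replaced by the less favourable one, which is the smaller for numbers below \<open>1\<close>
  and the larger for numbers above \<open>1\<close>.\<close>

lemma mixed_powr_kernel_le_tent:
  assumes x: "0 < x" and y: "0 < y" and a: "0 < a1" "0 < a2" and d: "a1 < d" "a2 < d"
  shows "mixed_powr y (a2, a1) * mixed_powr x (a1, a2) * min 1 ((x * y) powr (- d))
       \<le> tent (min a1 a2) (d - max a1 a2) (x * y)"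
proof -
  define m M where "m = min a1 a2" and "M = max a1 a2"
  have z: "0 < x * y" using x y by simp
  have d0: "0 < d" using a d by simp
  have min_eq: "min 1 ((x * y) powr (- d)) = (if x * y \<le> 1 then 1 else (x * y) powr (- d))"
    using z x y d0 powr_less_mono[of "- d" 0 "x * y"] powr_mono'[of "- d" 0 "x * y"] by auto
  have w: "mixed_powr y (a2, a1) * mixed_powr x (a1, a2) \<le> (if x * y \<le> 1 then (x * y) powr m else (x * y) powr M)"
  proof -
    have small: "t powr e \<le> t powr m" if "0 < t" "t \<le> 1" "e \<in> {a1, a2}" for t e :: real
      using that by (intro powr_mono') (auto simp: m_def)
    have large: "t powr e \<le> t powr M" if "1 \<le> t" "e \<in> {a1, a2}" for t e :: real
      using that by (intro powr_mono) (auto simp: M_def)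
    consider "x \<le> 1" "y \<le> 1" | "1 < x" "1 < y" | "x \<le> 1" "1 < y" | "1 < x" "y \<le> 1" by linarith
    then show ?thesis
    proof cases
      case 1
      then have "x * y \<le> 1" using x y by (simp add: mult_le_one)
      moreover have "y powr a2 * x powr a1 \<le> y powr m * x powr m"
        using 1 x y by (intro mult_mono small) auto
      ultimately show ?thesis using 1 x y by (simp add: mixed_powr_def powr_mult mult.commute)
    next
      case 2
      then have "1 < x * y" using less_1_mult by blast
      moreover have "y powr a1 * x powr a2 \<le> y powr M * x powr M"
        using 2 x y by (intro mult_mono large) auto
      ultimately show ?thesis using 2 x y by (simp add: mixed_powr_def powr_mult mult.commute)
    next
      case 3
      then have "mixed_powr y (a2, a1) * mixed_powr x (a1, a2) = (x * y) powr a1"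
        using x y by (simp add: mixed_powr_def powr_mult mult.commute)
      then show ?thesis using small[of "x * y" a1] large[of "x * y" a1] z by auto
    next
      case 4
      then have "mixed_powr y (a2, a1) * mixed_powr x (a1, a2) = (x * y) powr a2"
        using x y by (simp add: mixed_powr_def powr_mult mult.commute)
      then show ?thesis using small[of "x * y" a2] large[of "x * y" a2] z by auto
    qed
  qed
  have "mixed_powr y (a2, a1) * mixed_powr x (a1, a2) * min 1 ((x * y) powr (- d))
      \<le> (if x * y \<le> 1 then (x * y) powr m else (x * y) powr M) * min 1 ((x * y) powr (- d))"
    using w by (intro mult_right_mono) auto
  also have "\<dots> = tent m (d - M) (x * y)"
    unfolding min_eq by (simp add: tent_def flip: powr_add)
  finally show ?thesis by (simp add: m_def M_def)
qed

section \<open>The weighted norm inequality\<close>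

text \<open>A non-integrable function has Bochner integral \<open>0\<close>, so the bound persists for it.\<close>

lemma norm_set_lebesgue_integral_le_nn_integral:
  fixes f :: "'a \<Rightarrow> 'b::{banach, second_countable_topology}"
  shows "ennreal (norm (LINT x:A|M. f x)) \<le> (\<integral>\<^sup>+x\<in>A. ennreal (norm (f x)) \<partial>M)"
proof (cases "set_integrable M A f")
  case True
  then have "ennreal (norm (LINT x:A|M. f x)) \<le> (\<integral>\<^sup>+x. ennreal (norm (indicator A x *\<^sub>R f x)) \<partial>M)"
    unfolding set_lebesgue_integral_def set_integrable_def by (rule integral_norm_bound_ennreal)
  also have "\<dots> = (\<integral>\<^sup>+x\<in>A. ennreal (norm (f x)) \<partial>M)"
    by (intro nn_integral_cong) (auto simp: indicator_def)
  finally show ?thesis .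
next
  case False
  then show ?thesis
    by (simp add: set_lebesgue_integral_def set_integrable_def not_integrable_integral_eq)
qed

lemma Lp_norm_le:
  assumes p: "0 < p" and B: "0 \<le> B"
    and le: "(\<integral>\<^sup>+x\<in>{0<..}. ennreal (norm (f x) powr p) \<partial>lebesgue) \<le> ennreal B"
  shows "Lp_norm p f \<le> ennreal (B powr (1 / p))"
proof -
  let ?I = "\<integral>\<^sup>+x\<in>{0<..}. ennreal (norm (f x) powr p) \<partial>lebesgue"
  have "?I \<noteq> \<infinity>" using le by (auto simp: top_unique)
  moreover have "enn2real ?I \<le> B" using le B by (rule enn2real_leI[rotated])
  ultimately show ?thesis
    using p by (auto simp: Lp_norm_def Let_def intro!: ennreal_leI powr_mono2)
qed

theorem theorem1p5:
  fixes p q \<delta> \<beta>1 \<beta>2 \<gamma>1 \<gamma>2 :: real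
    and K :: "real \<Rightarrow> real \<Rightarrow> complex"
  assumes "1 < p" and "p \<le> q" and "0 < \<delta>"
    and "continuous_on ({0<..} \<times> {0<..}) (\<lambda>(x, y). K x y)"
    and "\<exists>c>0. \<forall>x>0. \<forall>y>0. norm (K x y) \<le> c * min 1 ((x * y) powr (- \<delta> / 2))"
    and "\<beta>1 - \<gamma>1 = \<beta>2 - \<gamma>2"
    and "\<beta>1 = \<gamma>1 + 1 / q - 1 / conj_exponent p"
    and "\<beta>2 = \<gamma>2 + 1 / q - 1 / conj_exponent p"
    and "1 / q - \<delta> / 2 < \<beta>1" and "\<beta>1 < 1 / q"
    and "1 / q - \<delta> / 2 < \<beta>2" and "\<beta>2 < 1 / q"
  shows "\<exists>C>0. \<forall>f. admissible \<delta> f \<longrightarrow>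
           Lp_norm q (\<lambda>y. complex_of_real (mixed_powr y (- \<beta>2, - \<beta>1)) * kernel_transform \<delta> K f y)
             \<le> ennreal C * Lp_norm p (\<lambda>x. complex_of_real (mixed_powr x (\<gamma>1 + \<delta>, \<gamma>2 + \<delta>)) * f x)"
proof -
  obtain c where c: "0 < c"
    and Kc: "\<And>x y. 0 < x \<Longrightarrow> 0 < y \<Longrightarrow> norm (K x y) \<le> c * min 1 ((x * y) powr (- \<delta> / 2))"
    using assms(5) by blast
  note p = \<open>1 < p\<close> and pq = \<open>p \<le> q\<close>
  have q: "1 < q" using p pq by simp
  define a1 a2 where "a1 = 1 / q - \<beta>1" and "a2 = 1 / q - \<beta>2"
  define a b where "a = min a1 a2" and "b = \<delta> / 2 - max a1 a2"
  define H where "H = 1 / a + 1 / b"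
  have a12: "0 < a1" "0 < a2" "a1 < \<delta> / 2" "a2 < \<delta> / 2"
    using assms by (auto simp: a1_def a2_def)
  then have a: "0 < a" and b: "0 < b" by (auto simp: a_def b_def)
  then have H: "0 < H" by (simp add: H_def add_pos_pos)
  have conj: "1 / conj_exponent p = 1 - 1 / p"
    using p by (simp add: conj_exponent_def field_simps)
  have gamma: "\<gamma>1 = 1 - 1 / p - a1" "\<gamma>2 = 1 - 1 / p - a2"
    using assms(7,8) by (simp_all add: a1_def a2_def conj)
  define k where "k x y = tent a b (x * y)" for x y :: real
  define C where "C = c * H powr (1 - 1 / p + 1 / q)"
  have C: "0 < C" using c H by (simp add: C_def)
  \<comment> \<open>The weights are rewritten for the Haar measure: the factor \<open>1 / x\<close> is its density, and
    \<open>x powr (1 / p)\<close> turns the \<open>L\<^sup>p\<close> norm for \<open>dx\<close> into the one for \<open>dx / x\<close>.\<close>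
  have weights: "mixed_powr y (- \<beta>2, - \<beta>1) * (x powr \<delta> * norm (K x y))
      \<le> c * (y powr (- (1 / q)) * (1 / x * (x powr (1 / p) * mixed_powr x (\<gamma>1 + \<delta>, \<gamma>2 + \<delta>) * k x y)))"
    if x: "0 < x" and y: "0 < y" for x y
  proof -
    have yw: "mixed_powr y (- \<beta>2, - \<beta>1) = y powr (- (1 / q)) * mixed_powr y (a2, a1)"
      by (simp add: powr_mult_mixed_powr a1_def a2_def)
    have xw: "x powr \<delta> = mixed_powr x (a1, a2) * (1 / x * (x powr (1 / p) * mixed_powr x (\<gamma>1 + \<delta>, \<gamma>2 + \<delta>)))"
      using x by (simp add: mixed_powr_def gamma powr_add powr_diff field_simps)
    have "mixed_powr y (- \<beta>2, - \<beta>1) * (x powr \<delta> * norm (K x y))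
        \<le> mixed_powr y (- \<beta>2, - \<beta>1) * (x powr \<delta> * (c * min 1 ((x * y) powr (- (\<delta> / 2)))))"
      using Kc[OF x y] by (intro mult_left_mono) (auto simp: mixed_powr_nonneg)
    also have "\<dots> = (c * (y powr (- (1 / q)) * (1 / x * (x powr (1 / p) * mixed_powr x (\<gamma>1 + \<delta>, \<gamma>2 + \<delta>))))) *
       (mixed_powr y (a2, a1) * mixed_powr x (a1, a2) * min 1 ((x * y) powr (- (\<delta> / 2))))"
      unfolding yw xw by (simp only: mult_ac)
    also have "\<dots> \<le> (c * (y powr (- (1 / q)) * (1 / x * (x powr (1 / p) * mixed_powr x (\<gamma>1 + \<delta>, \<gamma>2 + \<delta>))))) * k x y"
      unfolding k_def a_def b_def using c x y a12
      by (intro mult_left_mono mixed_powr_kernel_le_tent) (auto simp: mixed_powr_nonneg)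
    finally show ?thesis by (simp only: mult_ac)
  qed
  show ?thesis
  proof (intro exI[of _ C] conjI allI impI C)
    fix f assume "admissible \<delta> f"
    then have [measurable]: "f \<in> borel_measurable (lebesgue_on {0<..})"
      by (simp add: admissible_def)
    let ?g = "\<lambda>x. complex_of_real (mixed_powr x (\<gamma>1 + \<delta>, \<gamma>2 + \<delta>)) * f x"
    let ?F = "\<lambda>y. complex_of_real (mixed_powr y (- \<beta>2, - \<beta>1)) * kernel_transform \<delta> K f y"
    define J where "J = (\<integral>\<^sup>+x\<in>{0<..}. ennreal (norm (?g x) powr p) \<partial>lebesgue)"
    show "Lp_norm q ?F \<le> ennreal C * Lp_norm p ?g"
    proof (cases "J = \<infinity>")
      case True
      then show ?thesis using C by (simp add: Lp_norm_def J_def ennreal_mult_top)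
    next
      case False
      define A where "A = enn2real J"
      have A: "0 \<le> A" and JA: "J = ennreal A" using False by (auto simp: A_def top.not_eq_extremum)
      define u where "u x = x powr (1 / p) * norm (?g x)" for x
      have [measurable]: "u \<in> borel_measurable (lebesgue_on {0<..})"
        unfolding u_def by measurable
      have "(\<integral>\<^sup>+x. ennreal (u x powr p) \<partial>mult_haar) = (\<integral>\<^sup>+x\<in>{0<..}. ennreal (1 / x) * ennreal (u x powr p) \<partial>lebesgue)"
        by (rule nn_integral_mult_haar) measurable
      also have "\<dots> = J"
        unfolding J_def using p
        by (intro nn_integral_cong)
           (auto simp: u_def indicator_def powr_mult powr_powr simp flip: ennreal_mult)
      finally have uA: "(\<integral>\<^sup>+x. ennreal (u x powr p) \<partial>mult_haar) = ennreal A" by (simp add: JA)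
      define v where "v y = (\<integral>\<^sup>+x. ennreal (u x * k x y) \<partial>mult_haar)" for y
      have kH: "(\<integral>\<^sup>+x. ennreal (k x y) \<partial>mult_haar) \<le> ennreal H" if "0 < y" for y
        unfolding k_def H_def using a b that by (rule nn_integral_tent)
      have kH': "(\<integral>\<^sup>+y. ennreal (k x y) \<partial>mult_haar) \<le> ennreal H" if "0 < x" for x
        using kH[OF that] by (simp add: k_def mult.commute)
      have [measurable]: "case_prod k \<in> borel_measurable (mult_haar \<Otimes>\<^sub>M mult_haar)"
        unfolding k_def by measurable
      have u_haar: "u \<in> borel_measurable mult_haar" by measurable
      have k01: "0 \<le> k x y" "0 < x \<Longrightarrow> 0 < y \<Longrightarrow> k x y \<le> 1" for x y
        using a b by (auto simp: k_def tent_nonneg intro!: tent_le_1)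
      note bound = bounded_kernel_Lp_Lq[OF sigma_finite_mult_haar sigma_finite_mult_haar u_haar
          \<open>case_prod k \<in> _\<close> _ _ _ p pq H A _ _ uA, folded v_def]
      have v_fin: "v y < \<infinity>" if "0 < y" for y
        using that by (intro bound) (auto simp: u_def k01 kH kH')
      have v_int: "(\<integral>\<^sup>+y. ennreal (enn2real (v y) powr q) \<partial>mult_haar)
           \<le> ennreal (A powr (q / p) * H powr (q * (1 - 1 / p) + 1))"
        by (intro bound) (auto simp: u_def k01 kH kH')
      have F_le: "norm (?F y) \<le> c * (y powr (- (1 / q)) * enn2real (v y))" if y: "0 < y" for y
      proof -
        \<comment> \<open>A constant factor passes into the Bochner integral for every integrand, but into
          \<open>nn_integral\<close> only for measurable ones; so the weight is moved before taking norms.\<close>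
        have "?F y = (LINT x:{0<..}|lebesgue. complex_of_real (mixed_powr y (- \<beta>2, - \<beta>1))
            * (complex_of_real (x powr \<delta>) * f x * K x y))"
          by (simp add: kernel_transform_def)
        then have "ennreal (norm (?F y)) \<le> (\<integral>\<^sup>+x\<in>{0<..}. ennreal (norm (complex_of_real (mixed_powr y (- \<beta>2, - \<beta>1))
            * (complex_of_real (x powr \<delta>) * f x * K x y))) \<partial>lebesgue)"
          by (simp only: norm_set_lebesgue_integral_le_nn_integral)
        also have "\<dots> \<le> (\<integral>\<^sup>+x. ennreal (c * y powr (- (1 / q))) * (ennreal (1 / x) * ennreal (u x * k x y) * indicator {0<..} x) \<partial>lebesgue)"
        proof (intro nn_integral_mono)
          fix x :: real
          show "ennreal (norm (complex_of_real (mixed_powr y (- \<beta>2, - \<beta>1)) * (complex_of_real (x powr \<delta>) * f x * K x y)))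
              * indicator {0<..} x
            \<le> ennreal (c * y powr (- (1 / q))) * (ennreal (1 / x) * ennreal (u x * k x y) * indicator {0<..} x)"
          proof (cases "0 < x")
            case x: True
            have "norm (complex_of_real (mixed_powr y (- \<beta>2, - \<beta>1)) * (complex_of_real (x powr \<delta>) * f x * K x y))
                = mixed_powr y (- \<beta>2, - \<beta>1) * (x powr \<delta> * norm (K x y)) * norm (f x)"
              by (simp add: norm_mult mixed_powr_nonneg mult_ac)
            also have "\<dots> \<le> c * (y powr (- (1 / q)) * (1 / x * (x powr (1 / p) * mixed_powr x (\<gamma>1 + \<delta>, \<gamma>2 + \<delta>) * k x y))) * norm (f x)"
              by (intro mult_right_mono weights x y) auto
            also have "\<dots> = (c * y powr (- (1 / q))) * (1 / x * (u x * k x y))"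
              by (simp add: u_def norm_mult mixed_powr_nonneg mult_ac)
            finally show ?thesis using x c
              by (simp flip: ennreal_mult add: ennreal_leI u_def k01)
          qed simp
        qed
        also have "\<dots> = ennreal (c * y powr (- (1 / q))) * v y"
        proof -
          have "(\<lambda>x. ennreal (1 / x) * ennreal (u x * k x y)) \<in> borel_measurable (lebesgue_on {0<..})"
            unfolding k_def by measurable
          then have "(\<lambda>x. ennreal (1 / x) * ennreal (u x * k x y) * indicator {0<..} x) \<in> borel_measurable lebesgue"
            by (subst (asm) borel_measurable_restrict_space_iff_ennreal) auto
          moreover have "v y = (\<integral>\<^sup>+x\<in>{0<..}. ennreal (1 / x) * ennreal (u x * k x y) \<partial>lebesgue)"
            unfolding v_def k_def by (rule nn_integral_mult_haar) measurable
          ultimately show ?thesis by (simp add: nn_integral_cmult)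
        qed
        also have "\<dots> = ennreal (c * (y powr (- (1 / q)) * enn2real (v y)))"
          using v_fin[OF y] c by (simp add: ennreal_mult mult_ac)
        finally show ?thesis using c by (simp add: ennreal_le_iff)
      qed
      have v_meas: "(\<lambda>y. ennreal (enn2real (v y) powr q)) \<in> borel_measurable (lebesgue_on {0<..})"
      proof -
        interpret sigma_finite_measure mult_haar by (rule sigma_finite_mult_haar)
        have "(\<lambda>y. ennreal (enn2real (v y) powr q)) \<in> borel_measurable mult_haar"
          unfolding v_def k_def by measurable
        then show ?thesis by (simp cong: measurable_cong_sets add: sets_mult_haar)
      qed
      have "(\<integral>\<^sup>+y\<in>{0<..}. ennreal (norm (?F y) powr q) \<partial>lebesgue)
          \<le> (\<integral>\<^sup>+y. ennreal (c powr q) * (ennreal (1 / y) * ennreal (enn2real (v y) powr q) * indicator {0<..} y) \<partial>lebesgue)"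
      proof (intro nn_integral_mono)
        fix y :: real
        show "ennreal (norm (?F y) powr q) * indicator {0<..} y
          \<le> ennreal (c powr q) * (ennreal (1 / y) * ennreal (enn2real (v y) powr q) * indicator {0<..} y)"
        proof (cases "0 < y")
          case y: True
          have "norm (?F y) powr q \<le> (c * (y powr (- (1 / q)) * enn2real (v y))) powr q"
            using q by (intro powr_mono2 F_le y) auto
          also have "\<dots> = c powr q * (1 / y * enn2real (v y) powr q)"
            using q y c by (simp add: powr_mult powr_divide powr_powr powr_minus_divide)
          finally show ?thesis using y by (simp flip: ennreal_mult add: ennreal_leI)
        qed simp
      qed
      also have "\<dots> = ennreal (c powr q) * (\<integral>\<^sup>+y. ennreal (enn2real (v y) powr q) \<partial>mult_haar)"
      proof -
        have "(\<lambda>y. ennreal (1 / y) * ennreal (enn2real (v y) powr q)) \<in> borel_measurable (lebesgue_on {0<..})"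
          using v_meas by measurable
        then have "(\<lambda>y. ennreal (1 / y) * ennreal (enn2real (v y) powr q) * indicator {0<..} y) \<in> borel_measurable lebesgue"
          by (subst (asm) borel_measurable_restrict_space_iff_ennreal) auto
        then show ?thesis by (simp add: nn_integral_cmult nn_integral_mult_haar[OF v_meas])
      qed
      also have "\<dots> \<le> ennreal (c powr q) * ennreal (A powr (q / p) * H powr (q * (1 - 1 / p) + 1))"
        by (intro mult_left_mono v_int) auto
      also have "\<dots> = ennreal (c powr q * (A powr (q / p) * H powr (q * (1 - 1 / p) + 1)))"
        by (simp add: ennreal_mult)
      finally have "Lp_norm q ?F \<le> ennreal ((c powr q * (A powr (q / p) * H powr (q * (1 - 1 / p) + 1))) powr (1 / q))"
        using q by (intro Lp_norm_le) auto
      also have "(c powr q * (A powr (q / p) * H powr (q * (1 - 1 / p) + 1))) powr (1 / q) = C * A powr (1 / p)"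
      proof -
        have "(q * (1 - 1 / p) + 1) * (1 / q) = 1 - 1 / p + 1 / q" using q by (simp add: field_simps)
        then show ?thesis
          using q c by (simp add: C_def powr_mult powr_powr)
      qed
      also have "ennreal (C * A powr (1 / p)) = ennreal C * Lp_norm p ?g"
        using C False by (simp add: Lp_norm_def Let_def ennreal_mult A_def flip: J_def)
      finally show ?thesis .
    qed
  qed
qed

end
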